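(* Let $G$ be a finite group and let $Max_G=\{x_1,\dots,x_m\}$ be an essential cyclic set of $G$. If $icn(G)=1$, then $rc(\Gamma_G^e)=2$ if and only if $G$ has an awning.
   Context: Let $G$ be a finite group with identity $e$. The enhanced power graph $\Gamma_G^e$ has vertex set $G$, two distinct vertices $x,y$ being adjacent iff $x,y\in\langle z\rangle$ for some $z\in G$. For a connected graph $\Gamma$, an edge-colouring $\zeta:E(\Gamma)\to\{1,\dots,k\}$ (not necessarily proper) is a rainbow $k$-colouring if every pair of distinct vertices is joined by a path whose edges have pairwise distinct colours; $rc(\Gamma)$ is the minimum such $k$. An essential cyclic set $Max_G=\{x_1,\dots,x_m\}$ is a set of elements of $G$ such that $\langle x_1\rangle,\dots,\langle x_m\rangle$ are pairwise distinct and are exactly the maximal cyclic subgroups of $G$. The independence cyclic set is $ics(G)=\{x_i\in Max_G:\langle x_i\rangle\cap\langle x_j\rangle=\{e\}\text{ for all }j\neq i\}$ and $icn(G)=|ics(G)|$. Awning: given an ordering $x_1,\dots,x_m$ of $Max_G$, an awning is a family of indexed sets $H_1,\dots,H_{m-1}$, where $H_i=\{h_{i,i+1},\dots,h_{i,m}\}\subseteq\langle x_i\rangle$ is partitioned as $H_i=A_i\,\dot\cup\,B_i$, such that (1) $h_{i,j}\in\langle x_i\rangle\cap\langle x_j\rangle$ for all $i<j$; (2) whenever $i<j$, $2\le j\le m-1$, $s\in\{j+1,\dots,m\}$, $r\in\{i+1,\dots,m\}$ and $h_{j,s}=h_{i,r}$: (a) if $r=j$ and $h_{i,r}\in A_i$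 then $h_{j,s}\in B_j$; (b) if $r=j$ and $h_{i,r}\in B_i$ then $h_{j,s}\in A_j$; (c) if $r=s>j$ and $h_{i,r}\in A_i$ then $h_{j,r}\in A_j$; (d) if $r=s>j$ and $h_{i,r}\in B_i$ then $h_{j,r}\in B_j$. $G$ has an awning if an awning exists for some ordering of $Max_G$.
   Formalization: An awning is additionally required to have m ≥ 2 (at least one set H_1); otherwise a cyclic group G, for example of order 2, would have icn(G)=1 and the empty awning although rc is at most 1, and the equivalence would fail. *)

theory Defs
  imports "HOL-Algebra.Generated_Groups"
begin

subsection \<open>Rainbow connection number of a simple undirected graph\<close>

text \<open>A simple graph is a pair of a vertex set and a set of edges, every edge being a
  two-element set of vertices.\<close>

type_synonym 'a sgraph = "'a set \<times> 'a set set"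

definition path_edges :: "'a list \<Rightarrow> 'a set list" where
  "path_edges p = map (\<lambda>(u, v). {u, v}) (zip p (tl p))"

definition is_path :: "'a sgraph \<Rightarrow> 'a \<Rightarrow> 'a list \<Rightarrow> 'a \<Rightarrow> bool" where
  "is_path \<Gamma> x p y \<longleftrightarrow>
     p \<noteq> [] \<and> hd p = x \<and> last p = y \<and> distinct p \<and>
     set p \<subseteq> fst \<Gamma> \<and> set (path_edges p) \<subseteq> snd \<Gamma>"

definition rainbow_colouring :: "'a sgraph \<Rightarrow> nat \<Rightarrow> ('a set \<Rightarrow> nat) \<Rightarrow> bool" where
  "rainbow_colouring \<Gamma> k \<zeta> \<longleftrightarrow>
     (\<forall>d\<in>snd \<Gamma>. \<zeta> d \<in> {1..k}) \<and>
     (\<forall>x\<in>fst \<Gamma>. \<forall>y\<in>fst \<Gamma>. x \<noteq> y \<longrightarrow>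
        (\<exists>p. is_path \<Gamma> x p y \<and> distinct (map \<zeta> (path_edges p))))"

text \<open>Only meaningful for connected graphs (with finitely many edges): otherwise no rainbow
  colouring exists, and the value is unspecified.\<close>

definition rc :: "'a sgraph \<Rightarrow> nat" where
  "rc \<Gamma> = (LEAST k. \<exists>\<zeta>. rainbow_colouring \<Gamma> k \<zeta>)"


subsection \<open>The enhanced power graph\<close>

definition enhanced_power_graph :: "('a, 'b) monoid_scheme \<Rightarrow> 'a sgraph" where
  "enhanced_power_graph G =
     (carrier G,
      {{x, y} | x y. x \<in> carrier G \<and> y \<in> carrier G \<and> x \<noteq> y \<and>
         (\<exists>z\<in>carrier G. x \<in> generate G {z} \<and> y \<in> generate G {z})})"


subsection \<open>Essential cyclic sets and the independence cyclic number\<close>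

definition cyclic_subgroups :: "('a, 'b) monoid_scheme \<Rightarrow> 'a set set" where
  "cyclic_subgroups G = {generate G {x} | x. x \<in> carrier G}"

definition maximal_cyclic_subgroups :: "('a, 'b) monoid_scheme \<Rightarrow> 'a set set" where
  "maximal_cyclic_subgroups G =
     {H \<in> cyclic_subgroups G. \<forall>K\<in>cyclic_subgroups G. H \<subseteq> K \<longrightarrow> H = K}"

definition essential_cyclic_set :: "('a, 'b) monoid_scheme \<Rightarrow> 'a set \<Rightarrow> bool" where
  "essential_cyclic_set G M \<longleftrightarrow>
     M \<subseteq> carrier G \<and> bij_betw (\<lambda>x. generate G {x}) M (maximal_cyclic_subgroups G)"

definition ics :: "('a, 'b) monoid_scheme \<Rightarrow> 'a set \<Rightarrow> 'a set" where
  "ics G M = {x \<in> M. \<forall>y\<in>M. y \<noteq> x \<longrightarrow> generate G {x} \<inter> generate G {y} = {\<one>\<^bsub>G\<^esub>}}"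

definition icn :: "('a, 'b) monoid_scheme \<Rightarrow> 'a set \<Rightarrow> nat" where
  "icn G M = card (ics G M)"


subsection \<open>Awnings\<close>

text \<open>The elements are ordered as \<open>x 1, \<dots>, x m\<close>; only the values \<open>h i j\<close> with
  \<open>1 \<le> i < j \<le> m\<close> and \<open>A i\<close>, \<open>B i\<close> with \<open>1 \<le> i \<le> m - 1\<close> matter.

  \<open>H\<^sub>i = {h i j | j. i < j \<le> m}\<close> is a set of group elements: the \<open>h i j\<close> need not be distinct,
  equal ones lie in the same part, and either part may be empty.

  The condition \<open>2 \<le> m\<close> says that the family \<open>H\<^sub>1, \<dots>, H\<^sub>m\<^sub>-\<^sub>1\<close> has at least one member.
  Without it a cyclic group (\<open>m = 1\<close>) would have an empty awning, although its enhanced power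
  graph is complete and so never has rainbow connection number \<open>2\<close>.\<close>

definition is_awning ::
  "('a, 'b) monoid_scheme \<Rightarrow> nat \<Rightarrow> (nat \<Rightarrow> 'a) \<Rightarrow> (nat \<Rightarrow> nat \<Rightarrow> 'a) \<Rightarrow>
     (nat \<Rightarrow> 'a set) \<Rightarrow> (nat \<Rightarrow> 'a set) \<Rightarrow> bool" where
  "is_awning G m x h A B \<longleftrightarrow>
     2 \<le> m \<and>
     (\<forall>i\<in>{1..m-1}.
        h i ` {i+1..m} \<subseteq> generate G {x i} \<and>
        h i ` {i+1..m} = A i \<union> B i \<and> A i \<inter> B i = {}) \<and>
     (\<forall>i\<in>{1..m-1}. \<forall>j\<in>{i+1..m}. h i j \<in> generate G {x i} \<inter> generate G {x j}) \<and>
     (\<forall>i\<in>{1..m-1}. \<forall>j\<in>{2..m-1}. \<forall>s\<in>{j+1..m}. \<forall>r\<in>{i+1..m}.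
        i < j \<and> h j s = h i r \<longrightarrow>
          (r = j \<and> h i r \<in> A i \<longrightarrow> h j s \<in> B j) \<and>
          (r = j \<and> h i r \<in> B i \<longrightarrow> h j s \<in> A j) \<and>
          (r = s \<and> s > j \<and> h i r \<in> A i \<longrightarrow> h j r \<in> A j) \<and>
          (r = s \<and> s > j \<and> h i r \<in> B i \<longrightarrow> h j r \<in> B j))"

definition has_awning :: "('a, 'b) monoid_scheme \<Rightarrow> 'a set \<Rightarrow> bool" where
  "has_awning G M \<longleftrightarrow>
     (\<exists>x h A B. bij_betw x {1..card M} M \<and> is_awning G (card M) x h A B)"

end

theory Submission
  imports Defs "HOL-Algebra.Multiplicative_Group" "HOL-Computational_Algebra.Primes"
begin

text \<open>Under \<open>icn(G) = 1\<close> both sides of the equivalence are false. If \<open>G\<close> is cyclic, the graph is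
  complete and there are no two members to order. Otherwise three maximal cyclic subgroups intersect
  pairwise trivially. They can be joined by paths of length two through the identity only, so their
  generators need three colours at the identity; and the corresponding three \<open>h i j\<close> of an awning
  all equal the identity, which contradicts conditions (a)--(d).

  For the three subgroups, let \<open>N\<close> be the isolated maximal cyclic subgroup, which is normal by
  uniqueness, \<open>n \<in> N\<close> of prime order \<open>p\<close>, and \<open>M \<noteq> N\<close> another maximal cyclic subgroup. Suppose
  that the maximal cyclic subgroups other than \<open>N\<close> pairwise meet nontrivially. An element \<open>y\<close> of prime
  order in \<open>M \<inter> nMn\<^sup>-\<^sup>1\<close> commutes with \<open>n\<close>, since \<open>[n, y] \<in> N \<inter> M\<close>. A nontrivial element of
  \<open>M\<close> of prime order other than \<open>p\<close> cannot commute with \<open>n\<close>, as both would lie in one cyclic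
  subgroup. So \<open>y\<close> has order \<open>p\<close>, and so does \<open>ny\<close>, which lies in some maximal cyclic
  \<open>K \<noteq> M, N\<close>. An element of prime order in \<open>M \<inter> K\<close> commutes with \<open>y\<close> and \<open>ny\<close>, hence with \<open>n\<close>,
  so it has order \<open>p\<close> and generates \<open>ny\<close>, which puts \<open>n\<close> into \<open>M\<close>.\<close>

context group
begin

section \<open>Cyclic subgroups and elements of prime order\<close>

lemma generate_singleton_mono:
  assumes "b \<in> carrier G" "a \<in> generate G {b}"
  shows "generate G {a} \<subseteq> generate G {b}"
  using assms generate_is_subgroup generate_subgroup_incl by simp

lemma pow_mem_generate:
  assumes "a \<in> carrier G"
  shows "a [^] (k::nat) \<in> generate G {a}"
  using assms by (auto simp: generate_pow int_pow_int intro!: exI[of _ "int k"])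

text \<open>By Bezout, the exponent 1 is a multiple of \<open>k\<close> modulo \<open>p\<close>, and
  \<open>p\<close> is an exponent that kills \<open>y\<close>.\<close>

lemma mem_generate_pow_coprime:
  fixes k p :: nat
  assumes y: "y \<in> carrier G" and "y [^] p = \<one>" and "coprime k p"
  shows "y \<in> generate G {y [^] k}"
proof -
  obtain u v where uv: "u * int k + v * int p = 1"
    using bezout_int[of "int k" "int p"] assms(3) by auto
  have "y = y [^] (int k * u + int p * v)"
    using y uv by (simp add: mult.commute)
  also have "\<dots> = (y [^] k) [^] u \<otimes> (y [^] p) [^] v"
    using y by (simp add: int_pow_mult int_pow_pow flip: int_pow_int)
  also have "\<dots> = (y [^] k) [^] u"
    using y assms(2) by simp
  finally show ?thesis
    using y by (auto simp: generate_pow)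
qed

text \<open>In a finite cyclic group the solutions of \<open>v [^] r = \<one>\<close> form a cyclic
  group of order dividing \<open>r\<close>, so for prime \<open>r\<close> any nontrivial solution
  generates all of them.\<close>

lemma mem_generate_of_prime_order:
  fixes r :: nat
  assumes g: "g \<in> carrier G" "ord g \<noteq> 0" and r: "prime r"
    and u: "u \<in> generate G {g}" "u \<noteq> \<one>" "u [^] r = \<one>"
    and v: "v \<in> generate G {g}" "v [^] r = \<one>"
  shows "v \<in> generate G {u}"
proof -
  obtain a :: int where a: "u = g [^] a" using u g by (auto simp: generate_pow)
  obtain b :: int where b: "v = g [^] b" using v g by (auto simp: generate_pow)
  define d where "d = int (ord g)"
  have rr: "prime (int r)" using r by simp
  have da: "d dvd a * int r"
    using u(3) g(1) unfolding a d_def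
    by (simp add: int_pow_eq_id int_pow_pow flip: int_pow_int)
  have db: "d dvd b * int r"
    using v(2) g(1) unfolding b d_def
    by (simp add: int_pow_eq_id int_pow_pow flip: int_pow_int)
  have nda: "\<not> d dvd a"
    using u(2) g(1) unfolding a d_def by (simp add: int_pow_eq_id)
  \<comment> \<open>Otherwise \<open>d\<close> is coprime to \<open>r\<close>, and \<open>da\<close>
    gives \<open>d dvd a\<close>, contrary to \<open>nda\<close>.\<close>
  have "int r dvd d"
  proof (rule ccontr)
    assume "\<not> int r dvd d"
    then have "coprime d (int r)" using rr prime_imp_coprime coprime_commute by blast
    then show False using da nda coprime_dvd_mult_left_iff by blast
  qed
  then obtain e where e: "d = int r * e" by (elim dvdE)
  have r0: "int r \<noteq> 0" using rr by auto
  have "e dvd a" using da r0 unfolding e by (simp add: mult.commute)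
  then obtain a' where a': "a = e * a'" by (elim dvdE)
  have "e dvd b" using db r0 unfolding e by (simp add: mult.commute)
  then obtain b' where b': "b = e * b'" by (elim dvdE)
  have "\<not> int r dvd a'" using nda unfolding a' e by (auto simp: mult.commute)
  then have "coprime a' (int r)" using rr prime_imp_coprime coprime_commute by blast
  \<comment> \<open>\<open>s\<close> inverts \<open>a'\<close> modulo \<open>r\<close>; multiplied
    by \<open>e * b'\<close>, this makes \<open>b\<close> congruent to \<open>a * (b' * s)\<close>
    modulo \<open>d\<close>.\<close>
  then obtain s t where st: "s * a' + t * int r = 1"
    using bezout_int[of a' "int r"] by auto
  have "b = e * b' * (s * a' + t * int r)" using st b' by simp
  also have "\<dots> = a * (b' * s) + d * (b' * t)" unfolding a' e by (simp add: algebra_simps)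
  finally have "v = g [^] (a * (b' * s)) \<otimes> g [^] (d * (b' * t))"
    using g(1) b int_pow_mult by simp
  moreover have "g [^] (d * (b' * t)) = \<one>"
    using g(1) unfolding d_def by (simp add: int_pow_eq_id)
  ultimately have "v = u [^] (b' * s)"
    using g(1) unfolding a by (simp add: int_pow_pow)
  moreover have "u \<in> carrier G" using g(1) a by simp
  ultimately show ?thesis by (auto simp: generate_pow)
qed

text \<open>Prime order \<open>r\<close> is expressed as \<open>w [^] r = \<one>\<close> with
  \<open>w \<noteq> \<one>\<close>. A nontrivial \<open>w\<close> is replaced by
  \<open>w [^] k\<close>, where \<open>ord w = r * k\<close>.\<close>

lemma ex_prime_order:
  assumes fin: "finite (carrier G)" and K: "subgroup K G" "K \<noteq> {\<one>}"
  shows "\<exists>w r. w \<in> K \<and> w \<noteq> \<one> \<and> prime (r::nat) \<and> w [^] r = \<one>"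
proof -
  have "\<one> \<in> K" using K(1) by (rule subgroup.one_closed)
  then obtain w where w: "w \<in> K" "w \<noteq> \<one>" using K(2) by blast
  have wc: "w \<in> carrier G" using K(1) w(1) by (rule subgroup.mem_carrier)
  have "ord w \<noteq> 1" using w(2) unfolding ord_eq_1[OF wc] .
  then obtain r where r: "prime r" "r dvd ord w" using prime_factor_nat by blast
  then obtain k where k: "ord w = r * k" by (elim dvdE)
  have "ord w > 0" using ord_ge_1[OF fin wc] by simp
  have "w [^] k \<noteq> \<one>"
  proof
    assume "w [^] k = \<one>"
    then have "r * k dvd k" unfolding pow_eq_id[OF wc] k .
    moreover have "k > 0" using \<open>ord w > 0\<close> k by simp
    ultimately have "r * k \<le> k" by (rule dvd_imp_le)
    moreover have "r > 1" using r(1) prime_gt_1_nat by blast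
    ultimately show False using \<open>k > 0\<close> by simp
  qed
  moreover have "(w [^] k) [^] r = \<one>"
    using pow_ord_eq_1[OF wc] unfolding k nat_pow_pow[OF wc] mult.commute[of r k] .
  moreover have "w [^] k \<in> K"
    using subgroup_int_pow_closed[OF K(1) w(1), of "int k"] by (simp add: int_pow_int)
  ultimately show ?thesis using r(1) by auto
qed

text \<open>The \<open>r\<close>-th power of \<open>n \<otimes> y\<close> removes \<open>y\<close>
  and the \<open>p\<close>-th power removes \<open>n\<close>; by coprimality the powers that remain
  still generate \<open>n\<close> and \<open>y\<close>.\<close>

lemma coprime_commute_mem_generate:
  assumes c: "n \<in> carrier G" "y \<in> carrier G" "n \<otimes> y = y \<otimes> n"
    and p: "n [^] (p::nat) = \<one>" "y [^] (r::nat) = \<one>" "coprime p r"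
  shows "n \<in> generate G {n \<otimes> y}" "y \<in> generate G {n \<otimes> y}"
proof -
  let ?z = "n \<otimes> y"
  have z: "?z \<in> carrier G" using c by simp
  have "n [^] r = ?z [^] r" "y [^] p = ?z [^] p"
    using c(1,2) p(1,2) unfolding pow_mult_distrib[OF c(3,1,2)] by simp_all
  then have "n [^] r \<in> generate G {?z}" "y [^] p \<in> generate G {?z}"
    using pow_mem_generate[OF z] by simp_all
  moreover have "n \<in> generate G {n [^] r}" "y \<in> generate G {y [^] p}"
    using mem_generate_pow_coprime c p by (simp_all add: coprime_commute)
  ultimately show "n \<in> generate G {?z}" "y \<in> generate G {?z}"
    using generate_singleton_mono[OF z] by auto
qed

section \<open>Maximal cyclic subgroups and conjugation\<close>

lemma maximal_cyclic_subgroupE: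
  assumes "H \<in> maximal_cyclic_subgroups G"
  obtains g where "g \<in> carrier G" "H = generate G {g}"
    "\<And>z. z \<in> carrier G \<Longrightarrow> H \<subseteq> generate G {z} \<Longrightarrow> generate G {z} = H"
proof -
  have H: "H \<in> cyclic_subgroups G" "\<forall>K\<in>cyclic_subgroups G. H \<subseteq> K \<longrightarrow> H = K"
    using assms by (simp_all add: maximal_cyclic_subgroups_def)
  moreover obtain g where "g \<in> carrier G" "H = generate G {g}"
    using H(1) by (auto simp: cyclic_subgroups_def)
  moreover have "generate G {z} \<in> cyclic_subgroups G" if "z \<in> carrier G" for z
    using that by (auto simp: cyclic_subgroups_def)
  ultimately show thesis using that by metis
qed

lemma ex_maximal_cyclic_subgroup:
  assumes "finite (carrier G)" "a \<in> carrier G"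
  shows "\<exists>H\<in>maximal_cyclic_subgroups G. generate G {a} \<subseteq> H"
proof -
  have fin: "finite (cyclic_subgroups G)"
    using assms(1) unfolding cyclic_subgroups_def by simp
  have "generate G {a} \<in> cyclic_subgroups G"
    using assms(2) by (auto simp: cyclic_subgroups_def)
  from finite_has_maximal2[OF fin this] show ?thesis
    by (auto simp: maximal_cyclic_subgroups_def)
qed

lemma inv_mult_cancel:
  assumes "g \<in> carrier G" "h \<in> carrier G"
  shows "inv g \<otimes> (g \<otimes> h) = h" "g \<otimes> (inv g \<otimes> h) = h"
  using assms by (simp_all flip: m_assoc)

lemma conj_group_hom:
  assumes "g \<in> carrier G"
  shows "group_hom G G (\<lambda>h. g \<otimes> h \<otimes> inv g)"
proof unfold_locales
  show "(\<lambda>h. g \<otimes> h \<otimes> inv g) \<in> hom G G"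
    using assms by (auto simp: hom_def m_assoc inv_mult_cancel)
qed

lemma generate_conj:
  assumes "g \<in> carrier G" "a \<in> carrier G"
  shows "generate G {g \<otimes> a \<otimes> inv g} = (\<lambda>h. g \<otimes> h \<otimes> inv g) ` generate G {a}"
  using group_hom.generate_img[OF conj_group_hom[OF assms(1)], of "{a}"] assms(2) by simp

lemma conj_conj:
  assumes "g \<in> carrier G" "h \<in> carrier G"
  shows "inv g \<otimes> (g \<otimes> h \<otimes> inv g) \<otimes> g = h" "g \<otimes> (inv g \<otimes> h \<otimes> g) \<otimes> inv g = h"
  using assms by (simp_all add: m_assoc inv_mult_cancel)

text \<open>Conjugation by \<open>inv g\<close> pulls a cyclic group above the conjugate of
  \<open>H\<close> back to a cyclic group above \<open>H\<close>, where maximality applies.\<close>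

lemma conj_maximal_cyclic:
  assumes g: "g \<in> carrier G" and H: "H \<in> maximal_cyclic_subgroups G"
  shows "(\<lambda>h. g \<otimes> h \<otimes> inv g) ` H \<in> maximal_cyclic_subgroups G"
proof -
  obtain a where a: "a \<in> carrier G" "H = generate G {a}"
    and max: "\<And>z. z \<in> carrier G \<Longrightarrow> H \<subseteq> generate G {z} \<Longrightarrow> generate G {z} = H"
    using H by (rule maximal_cyclic_subgroupE) blast
  have HG: "H \<subseteq> carrier G" using a generate_incl by simp
  \<comment> \<open>\<open>?d\<close> keeps \<open>inv (inv g)\<close> so that it is literally the
    map of \<open>generate_conj\<close> for \<open>inv g\<close>.\<close>
  let ?c = "\<lambda>h. g \<otimes> h \<otimes> inv g" and ?d = "\<lambda>h. inv g \<otimes> h \<otimes> inv (inv g)"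
  have gen: "?c ` H = generate G {?c a}" using generate_conj[OF g a(1)] a(2) by simp
  have "?c ` H = generate G {z}" if z: "z \<in> carrier G" "?c ` H \<subseteq> generate G {z}" for z
  proof -
    have zG: "generate G {z} \<subseteq> carrier G" using z generate_incl by simp
    have "H \<subseteq> ?d ` generate G {z}"
    proof
      fix h assume h: "h \<in> H"
      then have "h = ?d (?c h)" using HG conj_conj(1)[OF g, of h] g by auto
      then show "h \<in> ?d ` generate G {z}" using h z(2) by blast
    qed
    also have "\<dots> = generate G {?d z}" using generate_conj[of "inv g" z] g z by simp
    finally have "?d ` generate G {z} = H"
      using max[of "?d z"] g z generate_conj[of "inv g" z] by simp
    then have "?c ` H = ?c ` ?d ` generate G {z}" by simp
    also have "\<dots> = id ` generate G {z}"
      unfolding image_image using zG g conj_conj(2)[OF g] by (intro image_cong) auto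
    finally show ?thesis by simp
  qed
  moreover have "?c ` H \<in> cyclic_subgroups G"
    unfolding cyclic_subgroups_def gen using g a(1) by auto
  ultimately show ?thesis
    unfolding maximal_cyclic_subgroups_def cyclic_subgroups_def by auto
qed

section \<open>Commuting elements and trivially intersecting maximal cyclic subgroups\<close>

lemma generate_singleton_commute:
  assumes g: "g \<in> carrier G" and "a \<in> generate G {g}" "b \<in> generate G {g}"
  shows "a \<otimes> b = b \<otimes> a"
proof -
  obtain i j :: int where "a = g [^] i" "b = g [^] j"
    using assms by (auto simp: generate_pow)
  then show ?thesis
    using g int_pow_mult[OF g, of i j] int_pow_mult[OF g, of j i] by (simp add: add.commute)
qed

lemma maximal_cyclic_subgroup_imp_subgroup:
  assumes "H \<in> maximal_cyclic_subgroups G"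
  shows "subgroup H G"
  using assms generate_is_subgroup by (auto elim!: maximal_cyclic_subgroupE)

text \<open>The commutator \<open>inv y \<otimes> inv n \<otimes> y \<otimes> n\<close> lies in
  \<open>N\<close> because \<open>N\<close> is normal, and in \<open>M\<close> as the product of
  \<open>inv y\<close> and a conjugate of \<open>y\<close> assumed to be in \<open>M\<close>; hence
  it is trivial.\<close>

lemma commute_of_conj_mem:
  assumes N: "N \<lhd> G" and M: "subgroup M G" and NM: "N \<inter> M = {\<one>}"
    and n: "n \<in> N" and y: "y \<in> M" "inv n \<otimes> y \<otimes> n \<in> M"
  shows "n \<otimes> y = y \<otimes> n"
proof -
  interpret N: normal N G by (rule N)
  interpret M: subgroup M G by (rule M)
  have nc: "n \<in> carrier G" and yc: "y \<in> carrier G" using n y by auto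
  let ?c = "inv y \<otimes> inv n \<otimes> y \<otimes> n"
  have "?c = inv y \<otimes> (inv n \<otimes> y \<otimes> n)" using nc yc by (simp add: m_assoc)
  then have "?c \<in> M" using y M.m_closed[of "inv y"] M.m_inv_closed by simp
  moreover have "?c \<in> N"
    using N.inv_op_closed1[of y "inv n"] n yc by simp
  ultimately have "?c = \<one>" using NM by blast
  then have "y \<otimes> (inv y \<otimes> (inv n \<otimes> (y \<otimes> n))) = y" using nc yc by (simp add: m_assoc)
  then have "inv n \<otimes> (y \<otimes> n) = y" using nc yc by (simp add: inv_mult_cancel)
  then have "n \<otimes> (inv n \<otimes> (y \<otimes> n)) = n \<otimes> y" by simp
  then show ?thesis using nc yc by (simp add: inv_mult_cancel)
qed

lemma ex_trivially_intersecting_maximal_cyclic: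
  assumes fin: "finite (carrier G)"
    and N: "N \<in> maximal_cyclic_subgroups G" "N \<lhd> G"
    and iso: "\<And>H. H \<in> maximal_cyclic_subgroups G \<Longrightarrow> H \<noteq> N \<Longrightarrow> N \<inter> H = {\<one>}"
    and M: "M \<in> maximal_cyclic_subgroups G" "M \<noteq> N"
  shows "\<exists>H\<in>maximal_cyclic_subgroups G. \<exists>K\<in>maximal_cyclic_subgroups G.
    H \<noteq> N \<and> K \<noteq> N \<and> H \<noteq> K \<and> H \<inter> K = {\<one>}"
proof (rule ccontr)
  assume "\<not> ?thesis"
  then have meet: "H \<inter> K \<noteq> {\<one>}" if "H \<in> maximal_cyclic_subgroups G"
    "K \<in> maximal_cyclic_subgroups G" "H \<noteq> N" "K \<noteq> N" "H \<noteq> K" for H K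
    using that by blast
  interpret N: normal N G by (rule N(2))
  interpret M: subgroup M G using M(1) by (rule maximal_cyclic_subgroup_imp_subgroup)
  obtain g where g: "g \<in> carrier G" "M = generate G {g}"
    and maxM: "\<And>z. z \<in> carrier G \<Longrightarrow> M \<subseteq> generate G {z} \<Longrightarrow> generate G {z} = M"
    using M(1) by (rule maximal_cyclic_subgroupE) blast
  obtain x where x: "x \<in> carrier G" "N = generate G {x}"
    and maxN: "\<And>z. z \<in> carrier G \<Longrightarrow> N \<subseteq> generate G {z} \<Longrightarrow> generate G {z} = N"
    using N(1) by (rule maximal_cyclic_subgroupE) blast
  have NM: "N \<inter> M = {\<one>}" using iso[OF M] .
  \<comment> \<open>A trivial \<open>M\<close> would be contained in \<open>N\<close>, and
    maximality would give \<open>M = N\<close>; the same holds with the roles exchanged.\<close>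
  have "M \<noteq> {\<one>}" using maxM[OF x(1)] M(2) N.one_closed unfolding x(2)[symmetric] by auto
  have "N \<noteq> {\<one>}" using maxN[OF g(1)] M(2) M.one_closed unfolding g(2)[symmetric] by auto
  \<comment> \<open>A maximal cyclic subgroup above \<open>z\<close> shares \<open>w\<close> with
    \<open>N\<close>, so isolation forces it to be \<open>N\<close>.\<close>
  have sub_N: "generate G {z} \<subseteq> N"
    if "z \<in> carrier G" "w \<in> generate G {z}" "w \<in> N" "w \<noteq> \<one>" for z w
  proof -
    obtain H where H: "H \<in> maximal_cyclic_subgroups G" "generate G {z} \<subseteq> H"
      using ex_maximal_cyclic_subgroup[OF fin \<open>z \<in> carrier G\<close>] by auto
    have "w \<in> N \<inter> H" using H(2) that(2,3) by auto
    then have "H = N" using iso[OF H(1)] that(4) by (cases "H = N") auto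
    then show ?thesis using H(2) by simp
  qed
  obtain n p where n: "n \<in> N" "n \<noteq> \<one>" "prime (p::nat)" "n [^] p = \<one>"
    using ex_prime_order[OF fin N.subgroup_axioms \<open>N \<noteq> {\<one>}\<close>] by auto
  have nc: "n \<in> carrier G" using n(1) by simp
  have nM: "n \<notin> M" using n NM by blast
  \<comment> \<open>The cyclic group of \<open>n \<otimes> w\<close> contains both elements; as it
    contains \<open>n\<close>, it lies in \<open>N\<close> by \<open>sub_N\<close>, which puts
    \<open>w\<close> into \<open>N \<inter> M\<close>.\<close>
  have no_commute: False
    if w: "w \<in> M" "w \<noteq> \<one>" "prime (q::nat)" "w [^] q = \<one>" "q \<noteq> p" "n \<otimes> w = w \<otimes> n" for w q
  proof -
    have wc: "w \<in> carrier G" using w(1) by simp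
    have "coprime p q" using n(3) w(3,5) by (simp add: primes_coprime)
    note gen = coprime_commute_mem_generate[OF nc wc w(6) n(4) w(4) this]
    then have "w \<in> N" using sub_N[of "n \<otimes> w" n] nc wc n by auto
    then show False using w(1,2) NM by blast
  qed
  let ?M' = "(\<lambda>h. n \<otimes> h \<otimes> inv n) ` M"
  have M': "?M' \<in> maximal_cyclic_subgroups G" using conj_maximal_cyclic[OF nc M(1)] .
  \<comment> \<open>Conjugation by \<open>n\<close> fixes \<open>n\<close>, so \<open>n\<close> in
    \<open>?M'\<close> would mean \<open>n\<close> in \<open>M\<close>.\<close>
  have "?M' \<noteq> N"
  proof
    assume "?M' = N"
    then have "n \<in> ?M'" using n(1) by simp
    then obtain h where h: "h \<in> M" "n \<otimes> h \<otimes> inv n = n" by auto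
    then have "h = inv n \<otimes> n \<otimes> n" using conj_conj(1)[OF nc, of h] by simp
    then show False using nc h(1) nM by simp
  qed
  \<comment> \<open>If \<open>M = ?M'\<close>, the intersection is \<open>M\<close> itself, which is
    nontrivial; otherwise \<open>meet\<close> applies.\<close>
  then have "M \<inter> ?M' \<noteq> {\<one>}"
    using meet[OF M(1) M' M(2)] \<open>M \<noteq> {\<one>}\<close> by (cases "M = ?M'") simp_all
  moreover have "subgroup (M \<inter> ?M') G"
    using M.subgroup_axioms maximal_cyclic_subgroup_imp_subgroup[OF M'] by (rule subgroups_Inter_pair)
  ultimately obtain y r where y: "y \<in> M" "y \<in> ?M'" "y \<noteq> \<one>" "prime (r::nat)" "y [^] r = \<one>"
    using ex_prime_order[OF fin, of "M \<inter> ?M'"] by auto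
  have yc: "y \<in> carrier G" using y(1) by simp
  obtain h where h: "h \<in> M" "y = n \<otimes> h \<otimes> inv n" using y(2) by auto
  then have "inv n \<otimes> y \<otimes> n = h" using conj_conj(1)[OF nc] by simp
  then have ny: "n \<otimes> y = y \<otimes> n"
    using commute_of_conj_mem[OF N(2) M.subgroup_axioms NM n(1) y(1)] h(1) by simp
  have "r = p" using no_commute[OF y(1,3,4,5) _ ny] by blast
  define z where "z = n \<otimes> y"
  have zc: "z \<in> carrier G" using nc yc z_def by simp
  have zp: "z [^] p = \<one>"
    unfolding z_def pow_mult_distrib[OF ny nc yc] using n(4) y(5) \<open>r = p\<close> by simp
  have n_eq: "n = z \<otimes> inv y" unfolding z_def using nc yc by (simp add: m_assoc)
  have y_eq: "y = inv n \<otimes> z" unfolding z_def using nc yc by (simp add: inv_mult_cancel)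
  have "z \<notin> N"
  proof
    assume "z \<in> N"
    then have "y \<in> N" unfolding y_eq using n(1) by simp
    then show False using y NM by blast
  qed
  have "z \<notin> M"
  proof
    assume "z \<in> M"
    then have "n \<in> M" unfolding n_eq using y(1) by simp
    then show False using nM by simp
  qed
  obtain K where K: "K \<in> maximal_cyclic_subgroups G" "generate G {z} \<subseteq> K"
    using ex_maximal_cyclic_subgroup[OF fin zc] by auto
  have zK: "z \<in> K" using K(2) generate.incl[of z "{z}" G] by auto
  then have "K \<noteq> N" "M \<noteq> K" using \<open>z \<notin> N\<close> \<open>z \<notin> M\<close> by auto
  then have "M \<inter> K \<noteq> {\<one>}" using meet M K(1) by simp
  moreover have "subgroup (M \<inter> K) G"
    using M.subgroup_axioms maximal_cyclic_subgroup_imp_subgroup[OF K(1)] by (rule subgroups_Inter_pair)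
  ultimately obtain w q where w: "w \<in> M" "w \<in> K" "w \<noteq> \<one>" "prime (q::nat)" "w [^] q = \<one>"
    using ex_prime_order[OF fin, of "M \<inter> K"] by auto
  have wc: "w \<in> carrier G" using w(1) by simp
  obtain k where k: "k \<in> carrier G" "K = generate G {k}"
    using K(1) by (rule maximal_cyclic_subgroupE) blast
  have wz: "w \<otimes> z = z \<otimes> w" using generate_singleton_commute[OF k(1)] w(2) zK k(2) by simp
  have wy: "w \<otimes> y = y \<otimes> w" using generate_singleton_commute[OF g(1)] w(1) y(1) g(2) by simp
  have "n \<otimes> w \<otimes> y = n \<otimes> y \<otimes> w" using nc yc wc wy by (simp add: m_assoc)
  also have "\<dots> = w \<otimes> n \<otimes> y" using wz nc yc wc unfolding z_def by (simp add: m_assoc)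
  finally have nw: "n \<otimes> w = w \<otimes> n" using nc yc wc by simp
  have "q = p" using no_commute[OF w(1,3,4,5) _ nw] by blast
  \<comment> \<open>Both \<open>z\<close> and \<open>w\<close> are killed by \<open>p\<close> inside
    the cyclic group \<open>K\<close>, whose subgroup of order \<open>p\<close> is generated by
    \<open>w\<close>.\<close>
  then have "z \<in> generate G {w}"
    using mem_generate_of_prime_order[OF k(1) _ n(3), of w z] ord_ge_1[OF fin k(1)] w k(2) zK zp
    by simp
  also have "generate G {w} \<subseteq> M"
    using generate_singleton_mono[OF g(1)] w(1) g(2) by simp
  finally show False using \<open>z \<notin> M\<close> by simp
qed

section \<open>Normality of the unique isolated maximal cyclic subgroup\<close>

lemma image_conj_conj:
  assumes g: "g \<in> carrier G" and "H \<subseteq> carrier G"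
  shows "(\<lambda>h. g \<otimes> h \<otimes> inv g) ` (\<lambda>h. inv g \<otimes> h \<otimes> inv (inv g)) ` H = H"
proof -
  have "g \<otimes> (inv g \<otimes> h \<otimes> inv (inv g)) \<otimes> inv g = id h" if "h \<in> H" for h
    using that assms conj_conj(2)[OF g, of h] by auto
  then show ?thesis unfolding image_image by simp
qed

text \<open>Conjugation permutes the maximal cyclic subgroups and preserves trivial intersections,
  so every conjugate of \<open>N\<close> is isolated too and equals \<open>N\<close> by
  uniqueness.\<close>

lemma normal_of_unique_isolated:
  assumes N: "N \<in> maximal_cyclic_subgroups G"
    and iso: "\<And>H. H \<in> maximal_cyclic_subgroups G \<Longrightarrow> H \<noteq> N \<Longrightarrow> N \<inter> H = {\<one>}"
    and uniq: "\<And>K. K \<in> maximal_cyclic_subgroups G \<Longrightarrow>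
      (\<And>H. H \<in> maximal_cyclic_subgroups G \<Longrightarrow> H \<noteq> K \<Longrightarrow> K \<inter> H = {\<one>}) \<Longrightarrow> K = N"
  shows "N \<lhd> G"
proof (rule normal_invI)
  show N_sub: "subgroup N G" using N by (rule maximal_cyclic_subgroup_imp_subgroup)
  fix g n assume g: "g \<in> carrier G" and n: "n \<in> N"
  let ?c = "\<lambda>h. g \<otimes> h \<otimes> inv g" and ?d = "\<lambda>h. inv g \<otimes> h \<otimes> inv (inv g)"
  have cN: "?c ` N \<in> maximal_cyclic_subgroups G" by (rule conj_maximal_cyclic[OF g N])
  have "?c ` N \<inter> H = {\<one>}" if H: "H \<in> maximal_cyclic_subgroups G" "H \<noteq> ?c ` N" for H
  proof -
    note H_sub = maximal_cyclic_subgroup_imp_subgroup[OF H(1)]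
    have HG: "H \<subseteq> carrier G" using H_sub by (rule subgroup.subset)
    have dH: "?d ` H \<in> maximal_cyclic_subgroups G"
      using conj_maximal_cyclic[of "inv g"] g H(1) by simp
    \<comment> \<open>Otherwise conjugating back by \<open>g\<close> would make \<open>H\<close> the
      excluded conjugate of \<open>N\<close>.\<close>
    have "?d ` H \<noteq> N" using image_conj_conj[OF g HG] H(2) by metis
    with dH have NdH: "N \<inter> ?d ` H = {\<one>}" by (rule iso)
    have "w = \<one>" if w: "w \<in> ?c ` N" "w \<in> H" for w
    proof -
      obtain k where k: "k \<in> N" "w = ?c k" using w(1) by (rule imageE) simp
      have kG: "k \<in> carrier G" using N_sub k(1) by (rule subgroup.mem_carrier)
      have "?d w = k" unfolding k(2) using conj_conj(1)[OF g kG] g by simp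
      then have "k \<in> N \<inter> ?d ` H" using k(1) w(2) by blast
      then have "k = \<one>" unfolding NdH by simp
      then show ?thesis unfolding k(2) using g by simp
    qed
    moreover have "\<one> \<in> H" using H_sub by (rule subgroup.one_closed)
    moreover have "\<one> \<in> ?c ` N"
      using maximal_cyclic_subgroup_imp_subgroup[OF cN] by (rule subgroup.one_closed)
    ultimately show ?thesis by blast
  qed
  with cN have "?c ` N = N" by (rule uniq)
  then show "?c n \<in> N" using n by auto
qed

section \<open>Essential cyclic sets\<close>

lemma essential_cyclic_setD:
  assumes M: "essential_cyclic_set G M" and x: "x \<in> M"
  shows "x \<in> carrier G" "generate G {x} \<in> maximal_cyclic_subgroups G"
    "y \<in> M \<Longrightarrow> generate G {x} = generate G {y} \<Longrightarrow> x = y"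
proof -
  have "M \<subseteq> carrier G" and inj: "inj_on (\<lambda>x. generate G {x}) M"
    and img: "(\<lambda>x. generate G {x}) ` M = maximal_cyclic_subgroups G"
    using M by (simp_all add: essential_cyclic_set_def bij_betw_def)
  then show "x \<in> carrier G" using x by auto
  show "generate G {x} \<in> maximal_cyclic_subgroups G" unfolding img[symmetric] using x by simp
  show "y \<in> M \<Longrightarrow> generate G {x} = generate G {y} \<Longrightarrow> x = y" using inj_onD[OF inj _ x] by simp
qed

lemma essential_cyclic_setE:
  assumes "essential_cyclic_set G M" and "H \<in> maximal_cyclic_subgroups G"
  obtains x where "x \<in> M" "H = generate G {x}"
proof -
  have "H \<in> (\<lambda>x. generate G {x}) ` M"
    using assms by (simp add: essential_cyclic_set_def bij_betw_def)
  then show thesis using that by auto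
qed

text \<open>The subgroup of \<open>x\<close> is the only isolated maximal cyclic subgroup, hence
  normal. Any other member of \<open>M\<close> shows that there is a second maximal cyclic subgroup,
  and then two that meet trivially exist besides that of \<open>x\<close>.\<close>

lemma ex_three_trivially_intersecting:
  assumes fin: "finite (carrier G)" and M: "essential_cyclic_set G M"
    and x: "ics G M = {x}" and "M \<noteq> {x}"
  shows "\<exists>y\<in>M. \<exists>z\<in>M. x \<noteq> y \<and> x \<noteq> z \<and> y \<noteq> z \<and>
    generate G {x} \<inter> generate G {y} = {\<one>} \<and> generate G {x} \<inter> generate G {z} = {\<one>} \<and>
    generate G {y} \<inter> generate G {z} = {\<one>}"
proof -
  have "x \<in> ics G M" using x by simp
  then have xM: "x \<in> M"
    and iso_x: "\<And>y. y \<in> M \<Longrightarrow> y \<noteq> x \<Longrightarrow> generate G {x} \<inter> generate G {y} = {\<one>}"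
    by (simp_all add: ics_def)
  obtain u where u: "u \<in> M" "u \<noteq> x" using xM \<open>M \<noteq> {x}\<close> by blast
  let ?N = "generate G {x}"
  note N = essential_cyclic_setD(2)[OF M xM]
  have iso: "?N \<inter> H = {\<one>}" if "H \<in> maximal_cyclic_subgroups G" "H \<noteq> ?N" for H
    using M that(1)
  proof (rule essential_cyclic_setE)
    fix y assume "y \<in> M" "H = generate G {y}"
    then show ?thesis using iso_x[of y] that(2) by auto
  qed
  have normal: "?N \<lhd> G"
  proof (rule normal_of_unique_isolated[OF N iso])
    fix K assume K: "K \<in> maximal_cyclic_subgroups G"
      and K_iso: "\<And>H. H \<in> maximal_cyclic_subgroups G \<Longrightarrow> H \<noteq> K \<Longrightarrow> K \<inter> H = {\<one>}"
    obtain k where k: "k \<in> M" "K = generate G {k}" using M K by (rule essential_cyclic_setE)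
    have "generate G {k} \<inter> generate G {y} = {\<one>}" if "y \<in> M" "y \<noteq> k" for y
      using K_iso[of "generate G {y}"] essential_cyclic_setD[OF M that(1)] k that(2) by auto
    then have "k \<in> ics G M" using k(1) by (simp add: ics_def)
    then show "K = ?N" using x k(2) by simp
  qed
  have "generate G {u} \<noteq> ?N" using essential_cyclic_setD(3)[OF M u(1) xM] u(2) by auto
  then obtain H K where H: "H \<in> maximal_cyclic_subgroups G" "H \<noteq> ?N"
    and K: "K \<in> maximal_cyclic_subgroups G" "K \<noteq> ?N" and HK: "H \<noteq> K" "H \<inter> K = {\<one>}"
    using ex_trivially_intersecting_maximal_cyclic[OF fin N normal iso
        essential_cyclic_setD(2)[OF M u(1)]] by auto
  obtain y where y: "y \<in> M" "H = generate G {y}" using M H(1) by (rule essential_cyclic_setE)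
  obtain z where z: "z \<in> M" "K = generate G {z}" using M K(1) by (rule essential_cyclic_setE)
  have "x \<noteq> y" "x \<noteq> z" "y \<noteq> z" using H(2) K(2) HK(1) y(2) z(2) by auto
  then show ?thesis
    using iso[OF H] iso[OF K] HK(2) y(1) z(1) unfolding y(2) z(2) by auto
qed

text \<open>This holds by maximality. It confines the neighbours of \<open>x\<close> in the graph to
  the cyclic group of \<open>x\<close>.\<close>

lemma generate_eq_of_essential_mem:
  assumes M: "essential_cyclic_set G M" and x: "x \<in> M"
    and z: "z \<in> carrier G" "x \<in> generate G {z}"
  shows "generate G {z} = generate G {x}"
  using essential_cyclic_setD(2)[OF M x] generate_singleton_mono[OF z] z(1)
  by (auto simp: maximal_cyclic_subgroups_def cyclic_subgroups_def)

section \<open>Edges and rainbow colourings of the enhanced power graph\<close>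

lemma enhanced_power_graph_edgeD:
  assumes "{u, v} \<in> snd (enhanced_power_graph G)"
  shows "\<exists>z\<in>carrier G. u \<in> generate G {z} \<and> v \<in> generate G {z}"
  using assms unfolding enhanced_power_graph_def by (auto simp: doubleton_eq_iff)

lemma enhanced_power_graph_edgeI:
  assumes "z \<in> carrier G" "u \<in> generate G {z}" "v \<in> generate G {z}" "u \<noteq> v"
  shows "{u, v} \<in> snd (enhanced_power_graph G)"
proof -
  have "generate G {z} \<subseteq> carrier G" using assms(1) generate_incl by simp
  then show ?thesis using assms unfolding enhanced_power_graph_def by auto
qed

lemma enhanced_power_graph_one_edge:
  assumes "u \<in> carrier G" "u \<noteq> \<one>"
  shows "{u, \<one>} \<in> snd (enhanced_power_graph G)" "{\<one>, u} \<in> snd (enhanced_power_graph G)"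
  using assms by (auto intro!: enhanced_power_graph_edgeI[of u] generate.incl generate.one)

text \<open>\<open>rc\<close> is a \<open>LEAST\<close>, so its value is informative only once some
  colouring exists. Giving all edges different colours works, as distinct vertices are joined by an
  edge or by a path through the identity.\<close>

lemma ex_rainbow_colouring:
  assumes fin: "finite (carrier G)"
  shows "\<exists>k \<zeta>. rainbow_colouring (enhanced_power_graph G) k \<zeta>"
proof -
  let ?E = "snd (enhanced_power_graph G)"
  have "?E \<subseteq> Pow (carrier G)" unfolding enhanced_power_graph_def by auto
  then have "finite ?E" using fin finite_subset by blast
  then obtain f where f: "bij_betw f ?E {0..<card ?E}" using ex_bij_betw_finite_nat by blast
  \<comment> \<open>The bijection counts from 0, the colours from 1.\<close>
  define \<zeta> where "\<zeta> d = Suc (f d)" for d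
  have inj: "\<zeta> d = \<zeta> d' \<Longrightarrow> d \<in> ?E \<Longrightarrow> d' \<in> ?E \<Longrightarrow> d = d'" for d d'
    using f by (auto simp: \<zeta>_def bij_betw_def dest: inj_onD)
  have "rainbow_colouring (enhanced_power_graph G) (card ?E) \<zeta>"
    unfolding rainbow_colouring_def
  proof (intro conjI ballI impI)
    fix d assume "d \<in> ?E"
    then have "f d \<in> {0..<card ?E}" using f by (auto simp: bij_betw_def)
    then show "\<zeta> d \<in> {1..card ?E}" by (simp add: \<zeta>_def)
  next
    fix x y assume "x \<in> fst (enhanced_power_graph G)" "y \<in> fst (enhanced_power_graph G)"
      and xy: "x \<noteq> y"
    then have c: "x \<in> carrier G" "y \<in> carrier G" by (simp_all add: enhanced_power_graph_def)
    show "\<exists>p. is_path (enhanced_power_graph G) x p y \<and> distinct (map \<zeta> (path_edges p))"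
    proof (cases "x = \<one> \<or> y = \<one>")
      case True
      then have "{x, y} \<in> ?E" using enhanced_power_graph_one_edge c xy by auto
      then show ?thesis using c xy
        by (intro exI[of _ "[x, y]"])
          (simp add: is_path_def path_edges_def enhanced_power_graph_def)
    next
      case False
      then have e: "{x, \<one>} \<in> ?E" "{\<one>, y} \<in> ?E"
        using enhanced_power_graph_one_edge c by auto
      have "{x, \<one>} \<noteq> {\<one>, y}" using xy False by (auto simp: doubleton_eq_iff)
      then have "\<zeta> {x, \<one>} \<noteq> \<zeta> {\<one>, y}" using inj e by blast
      moreover have "fst (enhanced_power_graph G) = carrier G"
        by (simp add: enhanced_power_graph_def)
      ultimately show ?thesis using e c xy False
        by (intro exI[of _ "[x, \<one>, y]"]) (auto simp: is_path_def path_edges_def)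
    qed
  qed
  then show ?thesis by blast
qed

lemma rainbow_colouring_one_of_cyclic:
  assumes "x \<in> carrier G" "carrier G \<subseteq> generate G {x}"
  shows "rainbow_colouring (enhanced_power_graph G) 1 (\<lambda>_. 1)"
  unfolding rainbow_colouring_def
proof (intro conjI ballI impI)
  fix u v assume "u \<in> fst (enhanced_power_graph G)" "v \<in> fst (enhanced_power_graph G)"
    and uv: "u \<noteq> v"
  then have c: "u \<in> carrier G" "v \<in> carrier G" by (simp_all add: enhanced_power_graph_def)
  then have "{u, v} \<in> snd (enhanced_power_graph G)"
    using assms uv by (intro enhanced_power_graph_edgeI[of x]) auto
  then show "\<exists>p. is_path (enhanced_power_graph G) u p v \<and>
      distinct (map (\<lambda>_. 1::nat) (path_edges p))"
    using c uv by (intro exI[of _ "[u, v]"])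
      (simp add: is_path_def path_edges_def enhanced_power_graph_def)
qed simp

text \<open>The midpoint of a rainbow path of length two between the two generators must lie in both
  maximal cyclic subgroups, so it is the identity.\<close>

lemma rainbow_two_colouring_one_edges:
  assumes M: "essential_cyclic_set G M" and x: "x \<in> M" and y: "y \<in> M" and "x \<noteq> y"
    and xy: "generate G {x} \<inter> generate G {y} = {\<one>}"
    and \<zeta>: "rainbow_colouring (enhanced_power_graph G) 2 \<zeta>"
  shows "\<zeta> {x, \<one>} \<noteq> \<zeta> {y, \<one>}" "\<zeta> {x, \<one>} \<in> {1..2}"
proof -
  let ?E = "snd (enhanced_power_graph G)"
  note xc = essential_cyclic_setD(1)[OF M x] and yc = essential_cyclic_setD(1)[OF M y]
  have nbr: "v \<in> generate G {w}" if "w \<in> M" "{w, v} \<in> ?E" for v w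
    using enhanced_power_graph_edgeD[OF that(2)] generate_eq_of_essential_mem[OF M that(1)] by auto
  \<comment> \<open>The identity lies in every subgroup, so \<open>x = \<one>\<close> would make the
    two maximal cyclic subgroups equal.\<close>
  have "x \<noteq> \<one>"
  proof
    assume "x = \<one>"
    then have "x \<in> generate G {y}" by (auto intro: generate.one)
    then show False
      using generate_eq_of_essential_mem[OF M x yc] essential_cyclic_setD(3)[OF M x y] \<open>x \<noteq> y\<close> by auto
  qed
  then show "\<zeta> {x, \<one>} \<in> {1..2}"
    using \<zeta> enhanced_power_graph_one_edge(1)[OF xc] by (auto simp: rainbow_colouring_def)
  obtain p where p: "is_path (enhanced_power_graph G) x p y" "distinct (map \<zeta> (path_edges p))"
  proof -
    have "x \<in> fst (enhanced_power_graph G)" "y \<in> fst (enhanced_power_graph G)"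
      using xc yc by (simp_all add: enhanced_power_graph_def)
    then show thesis using that \<zeta> \<open>x \<noteq> y\<close> unfolding rainbow_colouring_def by blast
  qed
  \<comment> \<open>A rainbow path has at most as many edges as there are colours, so here at most
    three vertices.\<close>
  have "set (path_edges p) \<subseteq> ?E" using p(1) by (simp add: is_path_def)
  then have "set (map \<zeta> (path_edges p)) \<subseteq> {1..2}"
    using \<zeta> by (auto simp: rainbow_colouring_def)
  then have "card (set (map \<zeta> (path_edges p))) \<le> card {1..2::nat}"
    by (intro card_mono) auto
  then have "length (path_edges p) \<le> 2" using distinct_card[OF p(2)] by simp
  then have len: "length p \<le> 3" by (simp add: path_edges_def)
  have "p \<noteq> []" "hd p = x" "last p = y" using p(1) by (simp_all add: is_path_def)
  then obtain q where q: "p = x # q" by (cases p) auto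
  then obtain w q' where q': "q = w # q'" using \<open>last p = y\<close> \<open>x \<noteq> y\<close> by (cases q) auto
  have xw: "{x, w} \<in> ?E" using p(1) by (simp add: q q' is_path_def path_edges_def)
  then have wx: "w \<in> generate G {x}" using nbr[OF x] by simp
  have "q' \<noteq> []"
  proof
    assume "q' = []"
    then have "y \<in> generate G {x}" using \<open>last p = y\<close> wx q q' by simp
    then show False
      using generate_eq_of_essential_mem[OF M y xc] essential_cyclic_setD(3)[OF M x y] \<open>x \<noteq> y\<close> by auto
  qed
  then have "q' = [y]" using len \<open>last p = y\<close> q q' by (cases q') auto
  then have "{y, w} \<in> ?E" "\<zeta> {x, w} \<noteq> \<zeta> {y, w}"
    using p by (simp_all add: q q' is_path_def path_edges_def insert_commute)
  moreover from this have "w \<in> generate G {y}" using nbr[OF y] by simp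
  then have "w = \<one>" using wx xy by auto
  ultimately show "\<zeta> {x, \<one>} \<noteq> \<zeta> {y, \<one>}" by simp
qed

lemma no_rainbow_two_colouring:
  assumes M: "essential_cyclic_set G M" and mem: "x \<in> M" "y \<in> M" "z \<in> M"
    and neq: "x \<noteq> y" "x \<noteq> z" "y \<noteq> z"
    and triv: "generate G {x} \<inter> generate G {y} = {\<one>}" "generate G {x} \<inter> generate G {z} = {\<one>}"
      "generate G {y} \<inter> generate G {z} = {\<one>}"
  shows "\<not> rainbow_colouring (enhanced_power_graph G) 2 \<zeta>"
proof
  assume \<zeta>: "rainbow_colouring (enhanced_power_graph G) 2 \<zeta>"
  \<comment> \<open>The range of the colour is stated only for the first generator of a pair, so the
    last pair is also taken in reverse order to bound the colour at \<open>z\<close>.\<close>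
  have zy: "generate G {z} \<inter> generate G {y} = {\<one>}" using triv(3) by auto
  note xy = rainbow_two_colouring_one_edges[OF M mem(1,2) neq(1) triv(1) \<zeta>]
  note xz = rainbow_two_colouring_one_edges[OF M mem(1,3) neq(2) triv(2) \<zeta>]
  note yz = rainbow_two_colouring_one_edges[OF M mem(2,3) neq(3) triv(3) \<zeta>]
  note zy = rainbow_two_colouring_one_edges[OF M mem(3,2) neq(3)[symmetric] zy \<zeta>]
  show False using xy xz yz zy by auto
qed

end

section \<open>Awnings and three trivially intersecting subgroups\<close>

text \<open>Suppose \<open>e\<close> lies in \<open>A a\<close>. Condition (a) with
  \<open>r = b\<close> puts it into \<open>B b\<close>, and condition (c) with \<open>r = c\<close>
  puts it into \<open>A b\<close>, but these parts are disjoint. The case of \<open>B a\<close> is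
  symmetric, by (b) and (d).\<close>

lemma awning_not_all_eq:
  assumes aw: "is_awning G m x h A B" and idx: "1 \<le> a" "a < b" "b < c" "c \<le> m"
    and eq: "h a b = e" "h a c = e" "h b c = e"
  shows False
proof -
  have part: "h i ` {i+1..m} = A i \<union> B i \<and> A i \<inter> B i = {}" if "i \<in> {1..m-1}" for i
    using aw[unfolded is_awning_def, THEN conjunct2, THEN conjunct1, THEN bspec, OF that]
    by (rule conjunct2)
  have H: "h a ` {a+1..m} = A a \<union> B a" and disj: "A b \<inter> B b = {}"
    using part[of a] part[of b] idx by simp_all
  have "e \<in> h a ` {a+1..m}" using idx eq by (intro image_eqI[of _ _ b]) auto
  then have "e \<in> A a \<or> e \<in> B a" unfolding H by simp
  \<comment> \<open>Condition (2) at \<open>i = a\<close>, \<open>j = b\<close>,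
    \<open>s = c\<close>; \<open>r\<close> stays free because both \<open>r = b\<close> and
    \<open>r = c\<close> are used.\<close>
  moreover have cond: "h b c = h a r \<longrightarrow>
      (r = b \<and> h a r \<in> A a \<longrightarrow> h b c \<in> B b) \<and> (r = b \<and> h a r \<in> B a \<longrightarrow> h b c \<in> A b) \<and>
      (r = c \<and> c > b \<and> h a r \<in> A a \<longrightarrow> h b r \<in> A b) \<and>
      (r = c \<and> c > b \<and> h a r \<in> B a \<longrightarrow> h b r \<in> B b)" if "r \<in> {a+1..m}" for r
  proof -
    have "a \<in> {1..m-1}" "b \<in> {2..m-1}" "c \<in> {b+1..m}" using idx by auto
    from aw[unfolded is_awning_def, THEN conjunct2, THEN conjunct2, THEN conjunct2,
        THEN bspec, OF this(1), THEN bspec, OF this(2), THEN bspec, OF this(3), THEN bspec, OF that]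
    show ?thesis using idx(2) by simp
  qed
  moreover have "e \<in> A a \<longrightarrow> e \<in> B b" "e \<in> B a \<longrightarrow> e \<in> A b"
    using cond[of b] idx eq by simp_all
  moreover have "e \<in> A a \<longrightarrow> e \<in> A b" "e \<in> B a \<longrightarrow> e \<in> B b"
    using cond[of c] idx eq by simp_all
  ultimately show False using disj by blast
qed

text \<open>The ordering of \<open>M\<close> is arbitrary, so the indices of \<open>u\<close>,
  \<open>v\<close>, \<open>w\<close> may come in any of six orders. In each, the three values of
  \<open>h\<close> lie in trivial intersections and all equal the identity.\<close>

lemma not_has_awning:
  assumes mem: "u \<in> M" "v \<in> M" "w \<in> M" and neq: "u \<noteq> v" "u \<noteq> w" "v \<noteq> w"
    and triv: "generate G {u} \<inter> generate G {v} = {\<one>\<^bsub>G\<^esub>}"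
      "generate G {u} \<inter> generate G {w} = {\<one>\<^bsub>G\<^esub>}" "generate G {v} \<inter> generate G {w} = {\<one>\<^bsub>G\<^esub>}"
  shows "\<not> has_awning G M"
proof
  assume "has_awning G M"
  then obtain x h A B where x: "bij_betw x {1..card M} M" and aw: "is_awning G (card M) x h A B"
    unfolding has_awning_def by blast
  define T where "T i j \<longleftrightarrow> generate G {x i} \<inter> generate G {x j} = {\<one>\<^bsub>G\<^esub>}" for i j
  have h: "h i j = \<one>\<^bsub>G\<^esub>" if "1 \<le> i" "i < j" "j \<le> card M" "T i j" for i j
  proof -
    have "h i j \<in> generate G {x i} \<inter> generate G {x j}"
      using aw that unfolding is_awning_def by simp
    then show ?thesis using that(4) unfolding T_def by simp
  qed
  have sorted: False if "1 \<le> a" "a < b" "b < c" "c \<le> card M" "T a b" "T a c" "T b c" for a b c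
    using awning_not_all_eq[OF aw that(1-4)] h[of a b] h[of a c] h[of b c] that by simp
  have "M = x ` {1..card M}" using x by (simp add: bij_betw_def)
  then have "u \<in> x ` {1..card M}" "v \<in> x ` {1..card M}" "w \<in> x ` {1..card M}"
    using mem by simp_all
  then obtain i j k where ijk: "i \<in> {1..card M}" "x i = u" "j \<in> {1..card M}" "x j = v"
    "k \<in> {1..card M}" "x k = w" by (elim imageE) simp
  have T: "T i j" "T i k" "T j k" "T j i" "T k i" "T k j"
    using triv unfolding T_def ijk by (simp_all add: Int_commute)
  have "i \<noteq> j" "i \<noteq> k" "j \<noteq> k" using ijk neq by auto
  then consider "i < j" "j < k" | "i < k" "k < j" | "j < i" "i < k" | "j < k" "k < i"
    | "k < i" "i < j" | "k < j" "j < i" by linarith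
  then show False
    using sorted[of i j k] sorted[of i k j] sorted[of j i k] sorted[of j k i] sorted[of k i j]
      sorted[of k j i] ijk(1,3,5) T by cases simp_all
qed

section \<open>Failure of both sides of the equivalence\<close>

theorem theorem3p2:
  fixes G :: "('a, 'b) monoid_scheme" and Max_G :: "'a set"
  assumes "group G"
    and "finite (carrier G)"
    and "essential_cyclic_set G Max_G"
    and "icn G Max_G = 1"
  shows "rc (enhanced_power_graph G) = 2 \<longleftrightarrow> has_awning G Max_G"
proof -
  interpret group G by fact
  note fin = assms(2) and M = assms(3)
  obtain x where x: "ics G Max_G = {x}"
    using assms(4) unfolding icn_def by (rule card_1_singletonE)
  show ?thesis
  proof (cases "Max_G = {x}")
    case True
    have "carrier G \<subseteq> generate G {x}"
    proof
      fix a assume a: "a \<in> carrier G"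
      obtain H where H: "H \<in> maximal_cyclic_subgroups G" "generate G {a} \<subseteq> H"
        using ex_maximal_cyclic_subgroup[OF fin a] by auto
      have "H = generate G {x}" using M H(1)
        by (rule essential_cyclic_setE) (simp add: True)
      then show "a \<in> generate G {x}" using H(2) generate.incl[of a "{a}" G] by auto
    qed
    then have "rainbow_colouring (enhanced_power_graph G) 1 (\<lambda>_. 1)"
      using essential_cyclic_setD(1)[OF M] True by (intro rainbow_colouring_one_of_cyclic) auto
    then have "rc (enhanced_power_graph G) \<le> 1" unfolding rc_def by (intro Least_le) auto
    \<comment> \<open>With a single maximal cyclic subgroup the requirement \<open>2 \<le> m\<close>
      fails.\<close>
    moreover have "\<not> has_awning G Max_G"
      using True by (simp add: has_awning_def is_awning_def)
    ultimately show ?thesis by simp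
  next
    case False
    have "x \<in> Max_G" using x by (auto simp: ics_def)
    then obtain y z where yz: "y \<in> Max_G" "z \<in> Max_G" "x \<noteq> y" "x \<noteq> z" "y \<noteq> z"
      "generate G {x} \<inter> generate G {y} = {\<one>\<^bsub>G\<^esub>}" "generate G {x} \<inter> generate G {z} = {\<one>\<^bsub>G\<^esub>}"
      "generate G {y} \<inter> generate G {z} = {\<one>\<^bsub>G\<^esub>}"
      using ex_three_trivially_intersecting[OF fin M x False] by auto
    \<comment> \<open>The least number is attained, so the value 2 would supply a rainbow colouring
      with two colours.\<close>
    have "\<exists>\<zeta>. rainbow_colouring (enhanced_power_graph G) (rc (enhanced_power_graph G)) \<zeta>"
      using ex_rainbow_colouring[OF fin] unfolding rc_def by (rule LeastI_ex)
    then have "rc (enhanced_power_graph G) \<noteq> 2"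
      using no_rainbow_two_colouring[OF M \<open>x \<in> Max_G\<close> yz] by auto
    moreover have "\<not> has_awning G Max_G" using not_has_awning[OF \<open>x \<in> Max_G\<close> yz] .
    ultimately show ?thesis by simp
  qed
qed

end
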